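(* Let $X$ be a Banach space, $(\Omega,\mathcal{A},P)$ a probability space, and let $L\subset C(K)$ be an $f$-algebra. Let $(W_t)_{t\ge 0}$ be a process with $W_t:\Omega\to ck(X)$ (elements of $ck(X)$ being identified with their images under $j$ in $C(K)$), which is $L$-valued and weakly continuous as a function of $t\ge 0$, and satisfies $W_0=0$. Suppose that $W_t$ and $W_t^2$ are Bochner integrable for each $t$. Then $(W_t)_t$ is a set-valued Brownian motion if and only if one of the following (equivalent) statements holds for every evaluation functional $f\in C(K)^*$ and all $0=t_0<t_1<\dots<t_m$: (i) The increments $f(W_{t_1}-W_{t_0}), f(W_{t_2}-W_{t_1}),\dots,f(W_{t_m}-W_{t_{m-1}})$ are independent and each increment $f(W_{t_{i+1}}-W_{t_i})$ is normally distributed with mean zero and variance $t_{i+1}-t_i$. (ii) The random variables $f(W_{t_1}),\dots,f(W_{t_m})$ are jointly normally distributed with means equal to zero and covariance matrix $$V=\begin{pmatrix} t_1&t_1&\cdots&t_1\\ t_1&t_2&\cdots&t_2\\ \vdots&\vdots&&\vdots\\ t_1&t_2&\cdots&t_m\end{pmatrix},$$ i.e. $V_{ik}=\min(t_i,t_k)$. (iii) The random variables $f(W_{t_1}),\dots,f(W_{t_m})$ have joint moment-generating function $$\varphi(u_1,\dots,u_m)=\exp\Big\{\tfrac12u_m^2(t_m-t_{m-1})\Big\}\exp\Big\{\tfrac12(u_{m-1}+u_m)^2(t_{m-1}-t_{m-2})\Big\}\cdots\exp\Big\{\tfrac12(u_1+u_2+\dots+u_m)^2t_1\Big\}$$ for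 every $u_1,\dots,u_m\in\mathbb{R}$.
   Context: For a Banach space $X$, $ck(X)$ is the family of nonempty compact convex subsets of $X$, with Minkowski addition, multiplication by scalars and the Hausdorff metric $d_H$. $K$ is a compact Hausdorff space and $j:ck(X)\to C(K)$ is a map (such $K,j$ exist) satisfying: (a) $j(\alpha A+\beta C)=\alpha j(A)+\beta j(C)$ for all $A,C\in ck(X)$, $\alpha,\beta\ge 0$; (b) $d_H(A,C)=\|j(A)-j(C)\|_\infty$; (c) $j(ck(X))$ is norm closed; (d) $j(\mathrm{co}(A\cup C))=\max\{j(A),j(C)\}$. Sets are identified with their images in $C(K)$: differences and products of sets are the elements $j(A)-j(C)$ and $j(A)\cdot j(C)$ of $C(K)$. $ck_r(X)$ denotes the collection of functions $r1_B$ with $r\in\mathbb{R}$, $B\in ck(X)$; $r1_B$ is identified with $r\,j(B)\in C(K)$. An evaluation functional is an $f\in C(K)^*$ of the form $f(x)=x(k)$ for some fixed $k\in K$. A process $(B_t)_t$ with values in $ck_r(X)\subset C(K)$ is a set-valued Brownian motion if: (1) there is an $f$-algebra $L$ such that $B_t(\omega)\in L$ for each $\omega\in\Omega$ and $t>0$; (2) $B_t$ and $B_t^2$ are $C(K)$-valued Bochner integrable functions for each $t>0$; (3) for every evaluation functional $f\in C(K)^*$ the process $(f(B_t))_t$ is a standard real Brownian motion. *)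

theory Defs
  imports "HOL-Probability.Probability"
begin

section \<open>Compact convex sets and their embedding into \<open>C(K)\<close>\<close>

text \<open>
  \<open>C(K)\<close> is the type \<open>'k \<Rightarrow>\<^sub>C real\<close> of bounded continuous functions with the sup norm, where
  \<open>'k\<close> is a Hausdorff space whose universe is assumed to be compact wherever this matters.
\<close>

definition ck :: "'x::real_normed_vector set set" where
  "ck = {A. A \<noteq> {} \<and> compact A \<and> convex A}"

definition hausdorff_dist :: "'x::metric_space set \<Rightarrow> 'x set \<Rightarrow> real" where
  "hausdorff_dist A C = max (SUP a\<in>A. infdist a C) (SUP c\<in>C. infdist c A)"

definition ck_embedding :: "('x::banach set \<Rightarrow> ('k::t2_space \<Rightarrow>\<^sub>C real)) \<Rightarrow> bool" where
  "ck_embedding j \<longleftrightarrow>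
     (\<forall>A\<in>ck. \<forall>C\<in>ck. \<forall>\<alpha>\<ge>0. \<forall>\<beta>\<ge>0.
        j {\<alpha> *\<^sub>R a + \<beta> *\<^sub>R c | a c. a \<in> A \<and> c \<in> C} = \<alpha> *\<^sub>R j A + \<beta> *\<^sub>R j C) \<and>
     (\<forall>A\<in>ck. \<forall>C\<in>ck. hausdorff_dist A C = norm (j A - j C)) \<and>
     closed (j ` ck) \<and>
     (\<forall>A\<in>ck. \<forall>C\<in>ck. \<forall>k.
        apply_bcontfun (j (convex hull (A \<union> C))) k
          = max (apply_bcontfun (j A) k) (apply_bcontfun (j C) k))"

text \<open>The functions \<open>r 1\<^sub>B\<close>, already identified with \<open>r j(B)\<close>.\<close>

definition ck_r :: "('x::banach set \<Rightarrow> ('k::t2_space \<Rightarrow>\<^sub>C real)) \<Rightarrow> ('k \<Rightarrow>\<^sub>C real) set" where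
  "ck_r j = {r *\<^sub>R j B | r B. B \<in> ck}"

definition cmult :: "('k::topological_space \<Rightarrow>\<^sub>C real) \<Rightarrow> ('k \<Rightarrow>\<^sub>C real) \<Rightarrow> ('k \<Rightarrow>\<^sub>C real)" where
  "cmult f g = Bcontfun (\<lambda>k. apply_bcontfun f k * apply_bcontfun g k)"

lemma apply_cmult: "apply_bcontfun (cmult f g) k = apply_bcontfun f k * apply_bcontfun g k"
proof -
  have "bounded (range (\<lambda>k. apply_bcontfun f k * apply_bcontfun g k))"
    unfolding bounded_iff
  proof (intro exI ballI, elim rangeE)
    fix y k assume "y = apply_bcontfun f k * apply_bcontfun g k"
    then show "norm y \<le> norm f * norm g"
      using norm_bounded[of f k] norm_bounded[of g k]
      by (simp add: abs_mult mult_mono)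
  qed
  moreover have "continuous_on UNIV (\<lambda>k. apply_bcontfun f k * apply_bcontfun g k)"
    by (intro continuous_on_mult) auto
  ultimately show ?thesis
    unfolding cmult_def by (subst Bcontfun_inverse) (auto simp: bcontfun_def)
qed

definition cle :: "('k::topological_space \<Rightarrow>\<^sub>C real) \<Rightarrow> ('k \<Rightarrow>\<^sub>C real) \<Rightarrow> bool" where
  "cle x y \<longleftrightarrow> (\<forall>k. apply_bcontfun x k \<le> apply_bcontfun y k)"

text \<open>
  An \<open>f\<close>-algebra in \<open>C(K)\<close> carries the linear structure, the order and the product of \<open>C(K)\<close>.
  Suprema and infima are those of the ordered set \<open>L\<close> itself; they are the pointwise ones when \<open>L\<close>
  is a sublattice of \<open>C(K)\<close>, but this is not required. As the product is commutative,
  the defining condition \<open>x \<and> y = 0, z \<ge> 0 \<Longrightarrow> (z x) \<and> y = (x z) \<and> y = 0\<close> needs one side only.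
\<close>

definition is_sup_in ::
    "('k::topological_space \<Rightarrow>\<^sub>C real) set \<Rightarrow> ('k \<Rightarrow>\<^sub>C real) \<Rightarrow> ('k \<Rightarrow>\<^sub>C real) \<Rightarrow> ('k \<Rightarrow>\<^sub>C real) \<Rightarrow> bool" where
  "is_sup_in L x y z \<longleftrightarrow>
     z \<in> L \<and> cle x z \<and> cle y z \<and> (\<forall>w\<in>L. cle x w \<and> cle y w \<longrightarrow> cle z w)"

definition is_inf_in ::
    "('k::topological_space \<Rightarrow>\<^sub>C real) set \<Rightarrow> ('k \<Rightarrow>\<^sub>C real) \<Rightarrow> ('k \<Rightarrow>\<^sub>C real) \<Rightarrow> ('k \<Rightarrow>\<^sub>C real) \<Rightarrow> bool" where
  "is_inf_in L x y z \<longleftrightarrow>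
     z \<in> L \<and> cle z x \<and> cle z y \<and> (\<forall>w\<in>L. cle w x \<and> cle w y \<longrightarrow> cle w z)"

definition f_algebra :: "('k::topological_space \<Rightarrow>\<^sub>C real) set \<Rightarrow> bool" where
  "f_algebra L \<longleftrightarrow>
     subspace L \<and>
     (\<forall>x\<in>L. \<forall>y\<in>L. (\<exists>z. is_sup_in L x y z) \<and> (\<exists>z. is_inf_in L x y z)) \<and>
     (\<forall>x\<in>L. \<forall>y\<in>L. cmult x y \<in> L) \<and>
     (\<forall>x\<in>L. \<forall>y\<in>L. cle 0 x \<and> cle 0 y \<longrightarrow> cle 0 (cmult x y)) \<and>
     (\<forall>x\<in>L. \<forall>y\<in>L. \<forall>z\<in>L. is_inf_in L x y 0 \<and> cle 0 z \<longrightarrow> is_inf_in L (cmult z x) y 0)"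

definition evaluation_functional :: "(('k::topological_space \<Rightarrow>\<^sub>C real) \<Rightarrow>\<^sub>L real) \<Rightarrow> bool" where
  "evaluation_functional f \<longleftrightarrow> (\<exists>k. \<forall>x. blinfun_apply f x = apply_bcontfun x k)"

section \<open>Brownian motion\<close>

text \<open>
  Bochner integrability in an arbitrary Banach space; the library predicate \<open>integrable\<close> needs a
  second countable target, which \<open>C(K)\<close> is not in general. The integrand
  \<open>norm (g \<omega> - s i \<omega>)\<close> may fail to be measurable on a null set only, where \<open>nn_integral\<close> agrees
  with the integral for the completion of \<open>M\<close>.
\<close>

definition bochner_integrable :: "'w measure \<Rightarrow> ('w \<Rightarrow> 'b::real_normed_vector) \<Rightarrow> bool" where
  "bochner_integrable M g \<longleftrightarrow>
     (\<exists>s. (\<forall>i::nat. Bochner_Integration.simple_bochner_integrable M (s i)) \<and>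
          (AE \<omega> in M. (\<lambda>i. s i \<omega>) \<longlonglongrightarrow> g \<omega>) \<and>
          ((\<lambda>i. \<integral>\<^sup>+\<omega>. norm (g \<omega> - s i \<omega>) \<partial>M) \<longlonglongrightarrow> 0))"

definition standard_brownian_motion :: "'w measure \<Rightarrow> (real \<Rightarrow> 'w \<Rightarrow> real) \<Rightarrow> bool" where
  "standard_brownian_motion M b \<longleftrightarrow>
     (\<forall>t\<ge>0. b t \<in> borel_measurable M) \<and>
     (AE \<omega> in M. b 0 \<omega> = 0) \<and>
     (\<forall>(m::nat) t. 0 \<le> t 0 \<and> (\<forall>i<m. t i < t (Suc i)) \<longrightarrow>
        prob_space.indep_vars M (\<lambda>_. borel) (\<lambda>i \<omega>. b (t (Suc i)) \<omega> - b (t i) \<omega>) {..<m}) \<and>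
     (\<forall>s t. 0 \<le> s \<and> s < t \<longrightarrow>
        distributed M lborel (\<lambda>\<omega>. b t \<omega> - b s \<omega>) (normal_density 0 (sqrt (t - s)))) \<and>
     (AE \<omega> in M. continuous_on {0..} (\<lambda>t. b t \<omega>))"

definition set_valued_brownian_motion ::
    "'w measure \<Rightarrow> ('x::banach set \<Rightarrow> ('k::t2_space \<Rightarrow>\<^sub>C real)) \<Rightarrow> (real \<Rightarrow> 'w \<Rightarrow> ('k \<Rightarrow>\<^sub>C real)) \<Rightarrow> bool"
  where
  "set_valued_brownian_motion M j B \<longleftrightarrow>
     (\<forall>t\<ge>0. \<forall>\<omega>\<in>space M. B t \<omega> \<in> ck_r j) \<and>
     (\<exists>L. f_algebra L \<and> (\<forall>t>0. \<forall>\<omega>\<in>space M. B t \<omega> \<in> L)) \<and>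
     (\<forall>t>0. bochner_integrable M (B t) \<and> bochner_integrable M (\<lambda>\<omega>. cmult (B t \<omega>) (B t \<omega>))) \<and>
     (\<forall>f. evaluation_functional f \<longrightarrow>
        standard_brownian_motion M (\<lambda>t \<omega>. blinfun_apply f (B t \<omega>)))"

section \<open>The three conditions on finite dimensional distributions\<close>

definition time_grid :: "nat \<Rightarrow> (nat \<Rightarrow> real) \<Rightarrow> bool" where
  "time_grid m t \<longleftrightarrow> 1 \<le> m \<and> t 0 = 0 \<and> (\<forall>i<m. t i < t (Suc i))"

definition indep_normal_increments ::
    "'w measure \<Rightarrow> (('k::topological_space \<Rightarrow>\<^sub>C real) \<Rightarrow>\<^sub>L real) \<Rightarrow> (real \<Rightarrow> 'w \<Rightarrow> ('k \<Rightarrow>\<^sub>C real)) \<Rightarrow>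
      nat \<Rightarrow> (nat \<Rightarrow> real) \<Rightarrow> bool" where
  "indep_normal_increments M f B m t \<longleftrightarrow>
     prob_space.indep_vars M (\<lambda>_. borel)
       (\<lambda>i \<omega>. blinfun_apply f (B (t (Suc i)) \<omega> - B (t i) \<omega>)) {..<m} \<and>
     (\<forall>i<m. distributed M lborel (\<lambda>\<omega>. blinfun_apply f (B (t (Suc i)) \<omega> - B (t i) \<omega>))
               (normal_density 0 (sqrt (t (Suc i) - t i))))"

text \<open>Constants count as (degenerate) normal random variables.\<close>

definition normal_rv :: "'w measure \<Rightarrow> ('w \<Rightarrow> real) \<Rightarrow> bool" where
  "normal_rv M X \<longleftrightarrow>
     X \<in> borel_measurable M \<and>
     ((\<exists>\<mu>. AE \<omega> in M. X \<omega> = \<mu>) \<or>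
      (\<exists>\<mu> \<sigma>. \<sigma> > 0 \<and> distributed M lborel X (normal_density \<mu> \<sigma>)))"

definition jointly_normal :: "'w measure \<Rightarrow> (nat \<Rightarrow> 'w \<Rightarrow> real) \<Rightarrow> nat set \<Rightarrow> bool" where
  "jointly_normal M X I \<longleftrightarrow>
     (\<forall>i\<in>I. X i \<in> borel_measurable M) \<and>
     (\<forall>u. normal_rv M (\<lambda>\<omega>. \<Sum>i\<in>I. u i * X i \<omega>))"

definition covariance :: "'w measure \<Rightarrow> ('w \<Rightarrow> real) \<Rightarrow> ('w \<Rightarrow> real) \<Rightarrow> real" where
  "covariance M X Y =
     (\<integral>\<omega>. (X \<omega> - (\<integral>\<omega>'. X \<omega>' \<partial>M)) * (Y \<omega> - (\<integral>\<omega>'. Y \<omega>' \<partial>M)) \<partial>M)"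

definition jointly_normal_min_covariance ::
    "'w measure \<Rightarrow> (('k::topological_space \<Rightarrow>\<^sub>C real) \<Rightarrow>\<^sub>L real) \<Rightarrow> (real \<Rightarrow> 'w \<Rightarrow> ('k \<Rightarrow>\<^sub>C real)) \<Rightarrow>
      nat \<Rightarrow> (nat \<Rightarrow> real) \<Rightarrow> bool" where
  "jointly_normal_min_covariance M f B m t \<longleftrightarrow>
     jointly_normal M (\<lambda>i \<omega>. blinfun_apply f (B (t i) \<omega>)) {1..m} \<and>
     (\<forall>i\<in>{1..m}. (\<integral>\<omega>. blinfun_apply f (B (t i) \<omega>) \<partial>M) = 0) \<and>
     (\<forall>i\<in>{1..m}. \<forall>k\<in>{1..m}.
        covariance M (\<lambda>\<omega>. blinfun_apply f (B (t i) \<omega>)) (\<lambda>\<omega>. blinfun_apply f (B (t k) \<omega>))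
          = min (t i) (t k))"

text \<open>Integrability is stated because the Bochner integral of a non-integrable function is \<open>0\<close>.\<close>

definition brownian_joint_mgf ::
    "'w measure \<Rightarrow> (('k::topological_space \<Rightarrow>\<^sub>C real) \<Rightarrow>\<^sub>L real) \<Rightarrow> (real \<Rightarrow> 'w \<Rightarrow> ('k \<Rightarrow>\<^sub>C real)) \<Rightarrow>
      nat \<Rightarrow> (nat \<Rightarrow> real) \<Rightarrow> bool" where
  "brownian_joint_mgf M f B m t \<longleftrightarrow>
     (\<forall>i\<in>{1..m}. (\<lambda>\<omega>. blinfun_apply f (B (t i) \<omega>)) \<in> borel_measurable M) \<and>
     (\<forall>u :: nat \<Rightarrow> real.
        integrable M (\<lambda>\<omega>. exp (\<Sum>i=1..m. u i * blinfun_apply f (B (t i) \<omega>))) \<and>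
        (\<integral>\<omega>. exp (\<Sum>i=1..m. u i * blinfun_apply f (B (t i) \<omega>)) \<partial>M)
          = (\<Prod>i=1..m. exp (1 / 2 * (\<Sum>l=i..m. u l)\<^sup>2 * (t i - t (i - 1)))))"

end

theory Submission
  imports Defs
begin

text \<open>
  All three conditions are compared with the joint moment generating function. A law on the real
  line with everywhere finite moment generating function is determined by it: expanding in power
  series yields the moments, hence the characteristic function. If the joint moment generating
  function of \<open>X\<^sub>1, \<dots>, X\<^sub>n\<close> factorises, then the \<open>X\<^sub>i\<close> are independent: in
  \<open>E (exp (\<Sum>i. c\<^sub>i X\<^sub>i))\<close> the factors \<open>exp (c\<^sub>i X\<^sub>i)\<close> are replaced one after the other by
  indicators of \<open>X\<^sub>i \<in> A\<^sub>i\<close>, applying the one-dimensional uniqueness to the law of \<open>X\<^sub>i\<close> under the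
  probability whose density is the normalised product of the remaining factors.
  Summation by parts translates between the values and the increments on a time grid.
\<close>

section \<open>Moment generating functions\<close>

text \<open>One of the exponents u X and -u X equals u |X|, and the other exponential is positive.
  This gives the dominating function for powers of X and for the exponential series.\<close>

lemma integrable_exp_abs:
  fixes X :: "'w \<Rightarrow> real"
  assumes "X \<in> borel_measurable M" and "\<And>u. integrable M (\<lambda>x. exp (u * X x))"
  shows "integrable M (\<lambda>x. exp (u * \<bar>X x\<bar>))"
proof (rule Bochner_Integration.integrable_bound)
  show "integrable M (\<lambda>x. exp (u * X x) + exp (- u * X x))"
    by (intro Bochner_Integration.integrable_add assms)
  show "AE x in M. norm (exp (u * \<bar>X x\<bar>)) \<le> norm (exp (u * X x) + exp (- u * X x))"
    by (simp add: abs_of_pos[OF add_pos_pos] abs_if[of "X _"])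
qed (use assms(1) in measurable)

text \<open>A single term of the exponential series with nonnegative terms cannot exceed its
  sum.\<close>

lemma power_le_fact_exp:
  fixes y :: real
  assumes "0 \<le> y"
  shows "y ^ n \<le> fact n * exp y"
proof -
  have "(\<lambda>n. y ^ n /\<^sub>R fact n) sums exp y"
    by (rule exp_converges)
  then have "(\<Sum>i\<in>{n}. y ^ i /\<^sub>R fact i) \<le> exp y"
    using assms unfolding sums_iff by (metis (no_types, lifting) empty_iff finite.intros sum_le_suminf
        scaleR_nonneg_nonneg zero_le_power inverse_nonnegative_iff_nonnegative fact_ge_zero)
  then show ?thesis
    by (simp add: field_simps)
qed

lemma integrable_power_of_exp:
  fixes X :: "'w \<Rightarrow> real"
  assumes X: "X \<in> borel_measurable M" and "\<And>u. integrable M (\<lambda>x. exp (u * X x))"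
  shows "integrable M (\<lambda>x. X x ^ n)"
proof (rule Bochner_Integration.integrable_bound)
  show "integrable M (\<lambda>x. fact n * exp (1 * \<bar>X x\<bar>))"
    by (intro integrable_mult_right integrable_exp_abs assms)
  show "AE x in M. norm (X x ^ n) \<le> norm (fact n * exp (1 * \<bar>X x\<bar>))"
    using power_le_fact_exp by (auto simp: power_abs abs_mult)
qed (use X in measurable)

text \<open>Termwise integration is justified because the norms of the terms add up to exp (|z|
  |X|), which is integrable. The field is left general: real z yields the moment generating
  function, imaginary z the characteristic function.\<close>

lemma sums_integral_exp:
  fixes X :: "'w \<Rightarrow> real" and z :: "'a::{real_normed_field,banach,second_countable_topology}"
  assumes X[measurable]: "X \<in> borel_measurable M"
    and int: "\<And>u. integrable M (\<lambda>x. exp (u * X x))"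
  shows "(\<lambda>n. (\<integral>x. X x ^ n \<partial>M) *\<^sub>R (z ^ n /\<^sub>R fact n)) sums (\<integral>x. exp (X x *\<^sub>R z) \<partial>M)"
proof -
  let ?f = "\<lambda>n x. X x ^ n *\<^sub>R (z ^ n /\<^sub>R fact n)"
  have f: "?f n x = (X x *\<^sub>R z) ^ n /\<^sub>R fact n" for n x
    by (simp add: scaleR_power mult.commute)
  have intf: "integrable M (?f n)" for n
    using integrable_power_of_exp[OF X int] by simp
  have sn: "(\<lambda>n. norm (?f n x)) sums exp (norm z * \<bar>X x\<bar>)" for x
    using exp_converges[of "norm z * \<bar>X x\<bar>"]
    by (simp add: norm_power power_abs field_simps norm_mult)
  have "summable (\<lambda>n. \<integral>x. norm (?f n x) \<partial>M)"
  proof (rule summableI_nonneg_bounded)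
    fix n
    have "(\<Sum>i<n. \<integral>x. norm (?f i x) \<partial>M) = (\<integral>x. (\<Sum>i<n. norm (?f i x)) \<partial>M)"
      using intf by (intro Bochner_Integration.integral_sum[symmetric] integrable_norm)
    also have "\<dots> \<le> (\<integral>x. exp (norm z * \<bar>X x\<bar>) \<partial>M)"
    proof (rule integral_mono)
      show "(\<Sum>i<n. norm (?f i x)) \<le> exp (norm z * \<bar>X x\<bar>)" for x
        using sn[of x] by (intro sum_le_suminf[of _ "{..<n}", THEN order_trans])
          (auto simp: sums_iff)
      show "integrable M (\<lambda>x. \<Sum>i<n. norm (?f i x))"
        by (intro Bochner_Integration.integrable_sum integrable_norm intf)
    qed (intro integrable_exp_abs X int)
    finally show "(\<Sum>i<n. \<integral>x. norm (?f i x) \<partial>M) \<le> (\<integral>x. exp (norm z * \<bar>X x\<bar>) \<partial>M)" .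
  qed simp
  then have "(\<lambda>n. \<integral>x. ?f n x \<partial>M) sums (\<integral>x. (\<Sum>n. ?f n x) \<partial>M)"
    using sn by (intro sums_integral intf) (auto intro: sums_summable)
  moreover have "(\<Sum>n. ?f n x) = exp (X x *\<^sub>R z)" for x
    unfolding f exp_def ..
  ultimately show ?thesis
    using intf integrable_power_of_exp[OF X int] by simp
qed

text \<open>Strong induction: if the coefficients below m agree, the difference of the two series
  can be divided by x^m for nonzero x, and letting x tend to 0 isolates the m-th
  coefficients.\<close>

lemma real_power_series_unique:
  fixes a b :: "nat \<Rightarrow> real"
  assumes a: "\<And>x. (\<lambda>n. a n * x ^ n) sums f x" and b: "\<And>x. (\<lambda>n. b n * x ^ n) sums f x"
  shows "a n = b n"
proof (induction n rule: less_induct)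
  case (less m)
  have "(\<lambda>n. (a (n + m) - b (n + m)) * x ^ n) sums 0" if "x \<noteq> 0" for x
  proof -
    have "(\<lambda>n. (a n - b n) * x ^ n) sums 0"
      using sums_diff[OF a[of x] b[of x]] by (simp add: algebra_simps)
    moreover have "(\<Sum>n<m. (a n - b n) * x ^ n) = 0"
      using less by simp
    ultimately have "(\<lambda>n. (a (n + m) - b (n + m)) * x ^ (n + m)) sums 0"
      by (subst sums_iff_shift) simp
    then have "(\<lambda>n. (a (n + m) - b (n + m)) * x ^ n * x ^ m) sums (0 * x ^ m)"
      by (simp add: power_add mult.assoc)
    then show ?thesis
      using that by (subst (asm) sums_mult2_iff) auto
  qed
  \<comment> \<open>Dividing by x^m leaves the sum known only for nonzero x, hence the punctured
    form of the limit theorem.\<close>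
  from powser_limit_0_strong[of 1, OF _ this]
  have "((\<lambda>_::real. 0) \<longlongrightarrow> a m - b m) (at 0)"
    by simp
  then show ?case
    using tendsto_unique[OF trivial_limit_at tendsto_const] by fastforce
qed

theorem mgf_uniqueness:
  assumes "real_distribution M" and "real_distribution N"
    and intM: "\<And>u. integrable M (\<lambda>x. exp (u * x))" and intN: "\<And>u. integrable N (\<lambda>x. exp (u * x))"
    and eq: "\<And>u. (\<integral>x. exp (u * x) \<partial>M) = (\<integral>x. exp (u * x) \<partial>N)"
  shows "M = N"
proof (rule Levy_uniqueness)
  interpret M: real_distribution M by fact
  interpret N: real_distribution N by fact
  note M = sums_integral_exp[of "\<lambda>x. x" M, OF _ intM, simplified]
  note N = sums_integral_exp[of "\<lambda>x. x" N, OF _ intN, simplified]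
  have "(\<integral>x. x ^ n \<partial>M) / fact n = (\<integral>x. x ^ n \<partial>N) / fact n" for n
  proof (rule real_power_series_unique)
    show "(\<lambda>n. (\<integral>x. x ^ n \<partial>M) / fact n * u ^ n) sums (\<integral>x. exp (u * x) \<partial>M)" for u :: real
      using M[of u] by (simp add: field_simps)
    show "(\<lambda>n. (\<integral>x. x ^ n \<partial>N) / fact n * u ^ n) sums (\<integral>x. exp (u * x) \<partial>M)" for u :: real
      using N[of u] unfolding eq by (simp add: field_simps)
  qed
  \<comment> \<open>Equal moments give equal expansions also at complex z, and z = i t produces the
    characteristic functions.\<close>
  then have "(\<integral>x. exp (x *\<^sub>R z) \<partial>M) = (\<integral>x. exp (x *\<^sub>R z) \<partial>N)" for z :: complex
    using M[of z] N[of z] by (simp add: sums_iff)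
  from this[of "\<i> * of_real _"] show "char M = char N"
    by (auto simp: char_def fun_eq_iff scaleR_conv_of_real mult_ac)
qed fact+

section \<open>Independence from a factorising joint moment generating function\<close>

text \<open>Z is normalised to a probability density. The factorisation says that X has the same
  moment generating function under the tilted measure as under M, hence the same law, and the two
  laws are compared on A.\<close>

lemma (in prob_space) tilted_mgf_imp_indep:
  fixes X Z :: "'a \<Rightarrow> real"
  assumes X[measurable]: "X \<in> borel_measurable M" and Z[measurable]: "Z \<in> borel_measurable M"
    and Z_nonneg: "\<And>x. 0 \<le> Z x"
    and intX: "\<And>u. integrable M (\<lambda>x. exp (u * X x))"
    and intZ: "\<And>u. integrable M (\<lambda>x. Z x * exp (u * X x))"
    and eq: "\<And>u. expectation (\<lambda>x. Z x * exp (u * X x)) = expectation Z * expectation (\<lambda>x. exp (u * X x))"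
    and A[measurable]: "A \<in> sets borel"
  shows "expectation (\<lambda>x. Z x * indicator A (X x)) = expectation Z * prob (X -` A \<inter> space M)"
\<comment> \<open>If Z has mean zero it cannot be normalised, but it then vanishes almost everywhere
  and both sides are 0.\<close>
proof (cases "expectation Z = 0")
  case True
  have "integrable M Z" using intZ[of 0] by simp
  then have "AE x in M. Z x = 0"
    using True Z_nonneg by (subst (asm) integral_nonneg_eq_0_iff_AE) auto
  then have "expectation (\<lambda>x. Z x * indicator A (X x)) = expectation (\<lambda>x. 0)"
    by (intro integral_cong_AE) auto
  then show ?thesis using True by simp
next
  case False
  define c where "c = expectation Z"
  have Zi: "integrable M Z" using intZ[of 0] by simp
  have c: "c > 0"
    using False Z_nonneg by (simp add: c_def less_le)
  define Q where "Q = density M (\<lambda>x. ennreal (Z x / c))"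
  have Q_int: "integral\<^sup>L Q g = expectation (\<lambda>x. Z x * g x) / c"
    if "g \<in> borel_measurable M" for g :: "'a \<Rightarrow> real"
    unfolding Q_def using that Z_nonneg c by (subst integral_density) auto
  interpret Q: prob_space Q
  proof
    have "emeasure Q (space Q) = (\<integral>\<^sup>+x. ennreal (Z x / c) \<partial>M)"
      unfolding Q_def by (subst emeasure_density) (auto intro!: nn_integral_cong)
    also have "\<dots> = ennreal (expectation (\<lambda>x. Z x / c))"
      using Z_nonneg c Zi by (intro nn_integral_eq_integral) auto
    finally show "emeasure Q (space Q) = 1"
      using c by (simp add: c_def)
  qed
  have XQ[measurable]: "X \<in> borel_measurable Q"
    unfolding Q_def by simp
  have "distr Q borel X = distr M borel X"
  proof (rule mgf_uniqueness)
    show "real_distribution (distr Q borel X)"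
      by (rule Q.real_distribution_distr) simp
    show "real_distribution (distr M borel X)"
      by (rule real_distribution_distr) simp
    show "integrable (distr M borel X) (\<lambda>x. exp (u * x))" for u
      using intX[of u] by (simp add: integrable_distr_eq)
    show "integrable (distr Q borel X) (\<lambda>x. exp (u * x))" for u
      using intZ[of u] Z_nonneg c
      by (simp add: integrable_distr_eq) (simp add: Q_def integrable_density)
    show "(\<integral>x. exp (u * x) \<partial>distr Q borel X) = (\<integral>x. exp (u * x) \<partial>distr M borel X)" for u
      using eq[of u] c by (simp add: integral_distr Q_int c_def)
  qed
  then have "measure (distr Q borel X) A = measure (distr M borel X) A"
    by simp
  then have "Q.prob (X -` A \<inter> space M) = prob (X -` A \<inter> space M)"
    by (simp add: measure_distr Q_def)
  moreover have "Q.prob (X -` A \<inter> space M) = (\<integral>x. indicator A (X x) \<partial>Q)"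
  proof -
    have "(\<integral>x. indicator A (X x) \<partial>Q) = (\<integral>x. indicator (X -` A \<inter> space M) x \<partial>Q :: real)"
      by (intro Bochner_Integration.integral_cong) (auto simp: Q_def indicator_def)
    then show ?thesis by (simp add: Q_def)
  qed
  ultimately show ?thesis
    using c by (simp add: Q_int c_def field_simps)
qed

text \<open>Induction on the set J of indices whose exponential has already been replaced by an
  indicator: J empty is the hypothesis, J = I is the product formula for events.\<close>

theorem (in prob_space) indep_vars_of_mgf:
  fixes X :: "'i \<Rightarrow> 'a \<Rightarrow> real"
  assumes I: "finite I"
    and X[measurable]: "\<And>i. i \<in> I \<Longrightarrow> X i \<in> borel_measurable M"
    and int: "\<And>c. integrable M (\<lambda>x. exp (\<Sum>i\<in>I. c i * X i x))"
    and eq: "\<And>c. expectation (\<lambda>x. exp (\<Sum>i\<in>I. c i * X i x))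
      = (\<Prod>i\<in>I. expectation (\<lambda>x. exp (c i * X i x)))"
  shows "indep_vars (\<lambda>_. borel) X I"
\<comment> \<open>The empty intersection is the whole type, so the product formula for preimages
  calls for a nonempty index set.\<close>
proof (cases "I = {}")
  case True
  then show ?thesis by (simp add: indep_vars_def indep_sets_def)
next
  case False
  have intX: "integrable M (\<lambda>x. exp (u * X i x))" if "i \<in> I" for i u
    using int[of "\<lambda>k. if k = i then u else 0"] that I
    by (simp add: if_distrib[of "\<lambda>a. a * _"] cong: if_cong)
  let ?Z = "\<lambda>J A c x. (\<Prod>i\<in>J. indicator (A i) (X i x)) * exp (\<Sum>i\<in>I - J. c i * X i x)"
  have main: "integrable M (?Z J A c) \<and> expectation (?Z J A c)
      = (\<Prod>i\<in>J. prob (X i -` A i \<inter> space M)) * (\<Prod>i\<in>I - J. expectation (\<lambda>x. exp (c i * X i x)))"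
    if "finite J" "J \<subseteq> I" "\<And>i. i \<in> I \<Longrightarrow> A i \<in> sets borel" for J A c
    using that
  proof (induction J arbitrary: c)
    case empty
    show ?case using int eq by simp
  next
    case (insert k J)
    \<comment> \<open>Z omits the factor of k, so \<open>Z x * exp (u * X k x)\<close> is the mixed
      product for J with coefficient u at k. This is why c varies in the induction.\<close>
    define Z where "Z x = (\<Prod>i\<in>J. indicator (A i) (X i x)) * exp (\<Sum>i\<in>I - insert k J. c i * X i x)" for x
    have k: "k \<in> I" "k \<notin> J" and A[measurable]: "\<And>i. i \<in> I \<Longrightarrow> A i \<in> sets borel"
      and JI: "J \<subseteq> I" using insert by auto
    have IJ: "I - J = insert k (I - insert k J)" using k by auto
    have Zu: "Z x * exp (u * X k x) = ?Z J A (c(k := u)) x" for u x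
    proof -
      have "(\<Sum>i\<in>I - J. (c(k := u)) i * X i x) = u * X k x + (\<Sum>i\<in>I - insert k J. c i * X i x)"
        unfolding IJ using I by (subst sum.insert) auto
      then show ?thesis by (simp add: Z_def exp_add mult_ac)
    qed
    have E: "(\<Prod>i\<in>I - J. expectation (\<lambda>x. exp ((c(k := u)) i * X i x)))
       = expectation (\<lambda>x. exp (u * X k x)) * (\<Prod>i\<in>I - insert k J. expectation (\<lambda>x. exp (c i * X i x)))" for u
      unfolding IJ using I by (subst prod.insert) auto
    have IH: "integrable M (\<lambda>x. Z x * exp (u * X k x))"
      "expectation (\<lambda>x. Z x * exp (u * X k x)) = (\<Prod>i\<in>J. prob (X i -` A i \<inter> space M)) *
         (expectation (\<lambda>x. exp (u * X k x)) * (\<Prod>i\<in>I - insert k J. expectation (\<lambda>x. exp (c i * X i x))))" for u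
      using insert.IH[of "c(k := u)"] JI A unfolding Zu E[symmetric] by auto
    \<comment> \<open>At u = 0 the factor of k becomes 1, which evaluates the mean of Z
      itself.\<close>
    have EZ: "integrable M Z" "expectation Z = (\<Prod>i\<in>J. prob (X i -` A i \<inter> space M)) *
         (\<Prod>i\<in>I - insert k J. expectation (\<lambda>x. exp (c i * X i x)))"
      using IH[of 0] by (simp_all add: prob_space)
    have Zk: "?Z (insert k J) A c x = Z x * indicator (A k) (X k x)" for x
      unfolding Z_def using k insert.hyps by (simp add: mult_ac)
    have [measurable]: "X k \<in> borel_measurable M" "A k \<in> sets borel" using k by auto
    have "integrable M (\<lambda>x. Z x * indicator (A k) (X k x))"
      by (rule Bochner_Integration.integrable_bound[OF EZ(1)])
        (use EZ(1) in \<open>auto simp: indicator_def\<close>)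
    moreover have "expectation (\<lambda>x. Z x * indicator (A k) (X k x)) = expectation Z * prob (X k -` A k \<inter> space M)"
    proof (rule tilted_mgf_imp_indep)
      show "0 \<le> Z x" for x unfolding Z_def by (intro mult_nonneg_nonneg prod_nonneg) auto
    qed (use EZ IH intX k in \<open>auto simp: mult_ac\<close>)
    ultimately show ?case
      unfolding Zk using EZ k insert.hyps by (simp add: mult_ac)
  qed
  show ?thesis
  proof (subst indep_vars_finite[where E = "\<lambda>_. sets borel"])
    show "\<forall>A\<in>I \<rightarrow> sets borel. prob (\<Inter>i\<in>I. X i -` A i \<inter> space M) = (\<Prod>i\<in>I. prob (X i -` A i \<inter> space M))"
    proof
      fix A :: "'i \<Rightarrow> real set" assume A: "A \<in> I \<rightarrow> sets borel"
      have "(\<Prod>i\<in>I. prob (X i -` A i \<inter> space M)) = expectation (\<lambda>x. \<Prod>i\<in>I. indicator (A i) (X i x))"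
        using main[of I A "\<lambda>_. 0"] I A by (auto simp: Pi_iff)
      also have "\<dots> = expectation (indicator (\<Inter>i\<in>I. X i -` A i \<inter> space M))"
        using I False by (intro Bochner_Integration.integral_cong)
          (auto simp: indicator_def prod.neutral intro!: prod_zero)
      also have "\<dots> = prob (\<Inter>i\<in>I. X i -` A i \<inter> space M)"
        using False by (simp add: Int_absorb1 INT_subset_iff)
      finally show "prob (\<Inter>i\<in>I. X i -` A i \<inter> space M) = (\<Prod>i\<in>I. prob (X i -` A i \<inter> space M))" ..
    qed
  qed (use I False in \<open>auto simp: sets.Int_stable sets.sigma_sets_eq[of borel, simplified]\<close>)
qed

section \<open>Normal distributions\<close>

text \<open>Completing the square: the factor exp (u x) shifts the mean by u sigma^2, keeps the
  variance, and leaves a constant in front of a density of mass 1.\<close>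

lemma has_bochner_integral_normal_exp:
  assumes "\<sigma> > 0"
  shows "has_bochner_integral lborel (\<lambda>x. normal_density \<mu> \<sigma> x * exp (u * x))
    (exp (u * \<mu> + u\<^sup>2 * \<sigma>\<^sup>2 / 2))"
proof -
  have "normal_density \<mu> \<sigma> x * exp (u * x)
      = exp (u * \<mu> + u\<^sup>2 * \<sigma>\<^sup>2 / 2) * normal_density (\<mu> + u * \<sigma>\<^sup>2) \<sigma> x" for x
    using assms
    by (simp add: normal_density_def mult_exp_exp)
      (simp add: field_simps power2_eq_square)
  moreover have "has_bochner_integral lborel (normal_density (\<mu> + u * \<sigma>\<^sup>2) \<sigma>) 1"
    using assms by (simp add: has_bochner_integral_iff)
  ultimately show ?thesis
    using has_bochner_integral_mult_right[of "exp (u * \<mu> + u\<^sup>2 * \<sigma>\<^sup>2 / 2)"] by fastforce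
qed

lemma normal_distributed_mgf:
  assumes "distributed M lborel X (normal_density \<mu> \<sigma>)" and "\<sigma> > 0"
  shows "integrable M (\<lambda>x. exp (u * X x))"
    and "(\<integral>x. exp (u * X x) \<partial>M) = exp (u * \<mu> + u\<^sup>2 * \<sigma>\<^sup>2 / 2)"
  using has_bochner_integral_normal_exp[OF assms(2), of \<mu> u]
    distributed_integrable[OF assms(1), of "\<lambda>x. exp (u * x)"]
    distributed_integral[OF assms(1), of "\<lambda>x. exp (u * x)"]
  by (auto simp: has_bochner_integral_iff)

lemma (in prob_space) normal_distributedI_mgf:
  assumes X[measurable]: "X \<in> borel_measurable M" and \<sigma>: "\<sigma> > 0"
    and int: "\<And>u. integrable M (\<lambda>x. exp (u * X x))"
    and mgf: "\<And>u. expectation (\<lambda>x. exp (u * X x)) = exp (u * \<mu> + u\<^sup>2 * \<sigma>\<^sup>2 / 2)"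
  shows "distributed M lborel X (normal_density \<mu> \<sigma>)"
proof -
  let ?N = "density lborel (normal_density \<mu> \<sigma>)"
  interpret N: prob_space ?N
    using \<sigma> by (rule prob_space_normal_density)
  have "distr M borel X = ?N"
  proof (rule mgf_uniqueness)
    show "real_distribution ?N"
      by unfold_locales auto
    show "integrable ?N (\<lambda>x. exp (u * x))" for u
      using has_bochner_integral_normal_exp[OF \<sigma>, of \<mu> u]
      by (simp add: integrable_density has_bochner_integral_iff)
    show "(\<integral>x. exp (u * x) \<partial>distr M borel X) = (\<integral>x. exp (u * x) \<partial>?N)" for u
      using has_bochner_integral_normal_exp[OF \<sigma>, of \<mu> u] mgf[of u]
      by (simp add: integral_density has_bochner_integral_iff integral_distr)
    show "integrable (distr M borel X) (\<lambda>x. exp (u * x))" for u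
      using int by (simp add: integrable_distr_eq)
  qed auto
  \<comment> \<open>Uniqueness was obtained over \<open>borel\<close>, while
    \<open>distributed\<close> refers to \<open>lborel\<close>; only the sigma-algebra matters
    here.\<close>
  moreover have "distr M lborel X = distr M borel X"
    by (intro distr_cong) auto
  ultimately show ?thesis
    unfolding distributed_def by auto
qed

text \<open>From left to right, the mean of a product of independent exponentials is the product of
  the means. Conversely, the marginals are read off first, and then the joint function is the
  product of the marginal ones.\<close>

lemma (in prob_space) indep_centered_normal_iff_mgf:
  fixes X :: "'i \<Rightarrow> 'a \<Rightarrow> real"
  assumes I: "finite I" and \<sigma>: "\<And>i. i \<in> I \<Longrightarrow> \<sigma> i > 0"
  shows "(indep_vars (\<lambda>_. borel) X I \<and> (\<forall>i\<in>I. distributed M lborel (X i) (normal_density 0 (\<sigma> i)))) \<longleftrightarrow>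
    (\<forall>i\<in>I. X i \<in> borel_measurable M) \<and>
    (\<forall>c. integrable M (\<lambda>x. exp (\<Sum>i\<in>I. c i * X i x)) \<and>
       expectation (\<lambda>x. exp (\<Sum>i\<in>I. c i * X i x)) = (\<Prod>i\<in>I. exp (1 / 2 * (c i)\<^sup>2 * (\<sigma> i)\<^sup>2)))"
    (is "?L \<longleftrightarrow> ?R")
proof
  assume L: ?L
  have "integrable M (\<lambda>x. exp (\<Sum>i\<in>I. c i * X i x)) \<and>
     expectation (\<lambda>x. exp (\<Sum>i\<in>I. c i * X i x)) = (\<Prod>i\<in>I. exp (1 / 2 * (c i)\<^sup>2 * (\<sigma> i)\<^sup>2))" for c
  proof -
    have ind: "indep_vars (\<lambda>_. borel) (\<lambda>i x. exp (c i * X i x)) I"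
      using L by (intro indep_vars_compose2[where Y = "\<lambda>i y. exp (c i * y)" and M' = "\<lambda>_. borel"]) auto
    have int: "integrable M (\<lambda>x. exp (c i * X i x))"
      and ev: "expectation (\<lambda>x. exp (c i * X i x)) = exp (1 / 2 * (c i)\<^sup>2 * (\<sigma> i)\<^sup>2)" if "i \<in> I" for i
      using L that \<sigma> normal_distributed_mgf[of M "X i" 0 "\<sigma> i" "c i"] by auto
    show ?thesis
      using indep_vars_integrable[OF I ind int] indep_vars_lebesgue_integral[OF I ind int] ev
      by (simp add: exp_sum I)
  qed
  then show ?R using L by (auto simp: indep_vars_def)
next
  assume R: ?R
  \<comment> \<open>Coefficients concentrated at i isolate \<open>X i\<close>; all other factors of
    the product are exp 0.\<close>
  have single: "integrable M (\<lambda>x. exp (u * X i x)) \<and>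
    expectation (\<lambda>x. exp (u * X i x)) = exp (1 / 2 * u\<^sup>2 * (\<sigma> i)\<^sup>2)" if "i \<in> I" for i u
  proof -
    have "(\<Sum>k\<in>I. (if k = i then u else 0) * X k x) = u * X i x" for x
      using that I by (simp add: if_distrib[of "\<lambda>a. a * _"] cong: if_cong)
    moreover have "(\<Prod>k\<in>I. exp (1 / 2 * (if k = i then u else 0)\<^sup>2 * (\<sigma> k)\<^sup>2)) = exp (1 / 2 * u\<^sup>2 * (\<sigma> i)\<^sup>2)"
      using that I by (simp add: if_distrib[of "\<lambda>a. exp (_ * a\<^sup>2 * _)"] cong: if_cong)
         (simp add: prod.remove[of I i] if_distrib cong: if_cong)
    ultimately show ?thesis
      using R[THEN conjunct2, rule_format, of "\<lambda>k. if k = i then u else 0"] by simp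
  qed
  have "indep_vars (\<lambda>_. borel) X I"
    by (rule indep_vars_of_mgf) (use I R single in auto)
  moreover have "distributed M lborel (X i) (normal_density 0 (\<sigma> i))" if "i \<in> I" for i
    by (rule normal_distributedI_mgf) (use that R \<sigma> single in auto)
  ultimately show ?L by blast
qed

text \<open>Constants obey the same formula with variance 0, so the degenerate case of
  \<open>normal_rv\<close> need not be distinguished by its users.\<close>

lemma (in prob_space) normal_rv_mgf:
  assumes "normal_rv M X"
  shows "integrable M (\<lambda>x. (X x)\<^sup>2)"
    and "integrable M (\<lambda>x. exp (u * X x))"
    and "expectation (\<lambda>x. exp (u * X x)) = exp (u * expectation X + u\<^sup>2 * variance X / 2)"
proof -
  have X[measurable]: "X \<in> borel_measurable M" using assms by (simp add: normal_rv_def)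
  have "integrable M (\<lambda>x. (X x)\<^sup>2) \<and> integrable M (\<lambda>x. exp (u * X x)) \<and>
    expectation (\<lambda>x. exp (u * X x)) = exp (u * expectation X + u\<^sup>2 * variance X / 2)"
    using assms unfolding normal_rv_def
  proof (elim conjE disjE exE)
    fix \<mu> assume c: "AE x in M. X x = \<mu>"
    have ev: "expectation (\<lambda>x. g (X x)) = g \<mu>" if [measurable]: "g \<in> borel_measurable borel" for g :: "real \<Rightarrow> real"
    proof -
      have "AE x in M. g (X x) = g \<mu>" using c by eventually_elim simp
      then have "expectation (\<lambda>x. g (X x)) = expectation (\<lambda>x. g \<mu>)"
        by (intro integral_cong_AE) auto
      then show ?thesis by (simp add: prob_space)
    qed
    have int: "integrable M (\<lambda>x. g (X x))" if [measurable]: "g \<in> borel_measurable borel" for g :: "real \<Rightarrow> real"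
      using c by (subst integrable_cong_AE[where g = "\<lambda>x. g \<mu>"]) auto
    show ?thesis
      using ev[of "\<lambda>x. x"] ev[of "\<lambda>x. (x - \<mu>)\<^sup>2"] ev[of "\<lambda>x. exp (u * x)"]
        int[of "\<lambda>x. x\<^sup>2"] int[of "\<lambda>x. exp (u * x)"] by simp
  next
    fix \<mu> \<sigma> :: real assume \<sigma>: "0 < \<sigma>" and d: "distributed M lborel X (normal_density \<mu> \<sigma>)"
    note mgf = normal_distributed_mgf[OF d \<sigma>]
    show ?thesis
      using integrable_power_of_exp[OF X mgf(1), of 2] mgf[of u]
        normal_distributed_expectation[OF \<sigma> d] normal_distributed_variance[OF \<sigma> d] by simp
  qed
  then show "integrable M (\<lambda>x. (X x)\<^sup>2)"
    and "integrable M (\<lambda>x. exp (u * X x))"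
    and "expectation (\<lambda>x. exp (u * X x)) = exp (u * expectation X + u\<^sup>2 * variance X / 2)"
    by blast+
qed

text \<open>For positive v the law is identified by uniqueness. For v = 0 there is no density, and X
  is shown to vanish almost everywhere.\<close>

lemma (in prob_space) centered_normal_rv_of_mgf:
  assumes X[measurable]: "X \<in> borel_measurable M" and v: "0 \<le> v"
    and int: "\<And>u. integrable M (\<lambda>x. exp (u * X x))"
    and mgf: "\<And>u. expectation (\<lambda>x. exp (u * X x)) = exp (u\<^sup>2 * v / 2)"
  shows "normal_rv M X" and "expectation X = 0" and "expectation (\<lambda>x. (X x)\<^sup>2) = v"
proof -
  have "normal_rv M X \<and> expectation X = 0 \<and> expectation (\<lambda>x. (X x)\<^sup>2) = v"
  proof (cases "v = 0")
    case True
    \<comment> \<open>This nonnegative function equals exp X + exp (-X) - 2, with mean 1 + 1 - 2 =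
      0, and it is zero only where X is zero.\<close>
    let ?g = "\<lambda>x. (exp (1 / 2 * X x) - exp (- 1 / 2 * X x))\<^sup>2"
    have g: "?g x = exp (1 * X x) + exp (- 1 * X x) - 2" for x
      by (simp add: power2_diff mult_exp_exp exp_double[symmetric])
    have "expectation ?g = 0"
      unfolding g using int[of 1] int[of "-1"] mgf[of 1] mgf[of "-1"] True by (simp add: prob_space)
    moreover have "integrable M ?g"
      unfolding g by (intro Bochner_Integration.integrable_add Bochner_Integration.integrable_diff int integrable_const)
    ultimately have "AE x in M. ?g x = 0"
      by (subst (asm) integral_nonneg_eq_0_iff_AE) auto
    then have z: "AE x in M. X x = 0"
      by eventually_elim simp
    have "expectation X = expectation (\<lambda>_. 0)" "expectation (\<lambda>x. (X x)\<^sup>2) = expectation (\<lambda>_. 0)"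
      using z by (intro integral_cong_AE; auto)+
    then show ?thesis using z True X by (auto simp: normal_rv_def)
  next
    case False
    with v have \<sigma>: "0 < sqrt v" by simp
    have d: "distributed M lborel X (normal_density 0 (sqrt v))"
      by (rule normal_distributedI_mgf) (use \<sigma> v int mgf in auto)
    then show ?thesis
      using normal_distributed_expectation[OF \<sigma> d] normal_distributed_variance[OF \<sigma> d] \<sigma> v X
      by (auto simp: normal_rv_def)
  qed
  then show "normal_rv M X" and "expectation X = 0" and "expectation (\<lambda>x. (X x)\<^sup>2) = v"
    by blast+
qed

section \<open>Jointly normal vectors\<close>

lemma integrable_mult_of_square:
  fixes X Y :: "'w \<Rightarrow> real"
  assumes [measurable]: "X \<in> borel_measurable M" "Y \<in> borel_measurable M"
    and "integrable M (\<lambda>x. (X x)\<^sup>2)" "integrable M (\<lambda>x. (Y x)\<^sup>2)"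
  shows "integrable M (\<lambda>x. X x * Y x)"
proof (rule Bochner_Integration.integrable_bound)
  show "integrable M (\<lambda>x. (X x)\<^sup>2 + (Y x)\<^sup>2)"
    by (intro Bochner_Integration.integrable_add assms)
  have "\<bar>a * b\<bar> \<le> a\<^sup>2 + b\<^sup>2" for a b :: real
    using sum_squares_bound[of "\<bar>a\<bar>" "\<bar>b\<bar>"] by (simp add: abs_mult mult.assoc)
      (smt (verit) mult_nonneg_nonneg abs_ge_zero)
  then show "AE x in M. norm (X x * Y x) \<le> norm ((X x)\<^sup>2 + (Y x)\<^sup>2)"
    by auto
qed simp

text \<open>Joint normality concerns all linear combinations, and so does the joint moment
  generating function; each combination is a one-dimensional question with variance given by the
  quadratic form of V. \<open>psd\<close> makes this form an admissible variance.\<close>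

theorem (in prob_space) jointly_normal_iff_mgf:
  fixes X :: "nat \<Rightarrow> 'a \<Rightarrow> real" and V :: "nat \<Rightarrow> nat \<Rightarrow> real"
  assumes I: "finite I" and sym: "\<And>i k. V i k = V k i"
    and psd: "\<And>u. 0 \<le> (\<Sum>i\<in>I. \<Sum>k\<in>I. u i * u k * V i k)"
  shows "(jointly_normal M X I \<and> (\<forall>i\<in>I. expectation (X i) = 0) \<and>
      (\<forall>i\<in>I. \<forall>k\<in>I. covariance M (X i) (X k) = V i k)) \<longleftrightarrow>
    (\<forall>i\<in>I. X i \<in> borel_measurable M) \<and>
    (\<forall>u. integrable M (\<lambda>x. exp (\<Sum>i\<in>I. u i * X i x)) \<and>
       expectation (\<lambda>x. exp (\<Sum>i\<in>I. u i * X i x)) = exp (1 / 2 * (\<Sum>i\<in>I. \<Sum>k\<in>I. u i * u k * V i k)))"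
    (is "?L \<longleftrightarrow> ?R")
proof
  have unit: "(\<Sum>k\<in>I. (if k = i then 1 else 0) * f k) = f i" if "i \<in> I" for i and f :: "nat \<Rightarrow> real"
    using that I by (simp add: if_distrib[of "\<lambda>a. a * _"] cong: if_cong)
  {
    assume L: ?L
    have X: "X i \<in> borel_measurable M" if "i \<in> I" for i
      using L that by (auto simp: jointly_normal_def)
    have N: "normal_rv M (\<lambda>x. \<Sum>i\<in>I. u i * X i x)" for u
      using L by (auto simp: jointly_normal_def)
    have sq: "integrable M (\<lambda>x. (X i x)\<^sup>2)" if "i \<in> I" for i
      using normal_rv_mgf(1)[OF N[of "\<lambda>k. if k = i then 1 else 0"]] that by (simp only: unit)
    have int1: "integrable M (X i)" if "i \<in> I" for i
      by (rule square_integrable_imp_integrable) (use X sq that in auto)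
    have int2: "integrable M (\<lambda>x. X i x * X k x)" if "i \<in> I" "k \<in> I" for i k
      by (rule integrable_mult_of_square) (use X sq that in auto)
    have mean: "expectation (\<lambda>x. \<Sum>i\<in>I. u i * X i x) = 0" for u
      using L int1 by (subst Bochner_Integration.integral_sum) auto
    \<comment> \<open>All means are 0, so the second moment of a linear combination is its variance;
      expanding the square gives the quadratic form.\<close>
    have "expectation (\<lambda>x. ((\<Sum>i\<in>I. u i * X i x) - 0)\<^sup>2) = expectation (\<lambda>x. \<Sum>i\<in>I. \<Sum>k\<in>I. u i * u k * (X i x * X k x))" for u
      by (simp add: power2_eq_square sum_product mult_ac)
    also have "\<dots> u = (\<Sum>i\<in>I. \<Sum>k\<in>I. u i * u k * expectation (\<lambda>x. X i x * X k x))" for u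
      using int2 by (simp add: Bochner_Integration.integral_sum)
    also have "\<dots> u = (\<Sum>i\<in>I. \<Sum>k\<in>I. u i * u k * V i k)" for u
      using L by (intro sum.cong refl) (auto simp: covariance_def)
    finally have var: "expectation (\<lambda>x. ((\<Sum>i\<in>I. u i * X i x) - 0)\<^sup>2) = (\<Sum>i\<in>I. \<Sum>k\<in>I. u i * u k * V i k)" for u .
    show ?R
      using X normal_rv_mgf(2,3)[OF N, of 1] unfolding mean var by auto
  }
  {
    assume R: ?R
    define Q where "Q u = (\<Sum>i\<in>I. \<Sum>k\<in>I. u i * u k * V i k)" for u
    define Y where "Y u x = (\<Sum>i\<in>I. u i * X i x)" for u x
    have X[measurable]: "X i \<in> borel_measurable M" if "i \<in> I" for i
      using R that by auto
    have Ym: "Y u \<in> borel_measurable M" for u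
      unfolding Y_def by (intro borel_measurable_sum borel_measurable_times) auto
    \<comment> \<open>Scaling the coefficients by s turns the joint function into the
      one-dimensional moment generating function of \<open>Y u\<close> at s.\<close>
    have sY: "s * Y u x = (\<Sum>i\<in>I. (s * u i) * X i x)" for s u x
      by (simp add: Y_def sum_distrib_left mult.assoc)
    have sQ: "(\<Sum>i\<in>I. \<Sum>k\<in>I. (s * u i) * (s * u k) * V i k) = s\<^sup>2 * Q u" for s u
      by (simp add: Q_def sum_distrib_left power2_eq_square mult_ac)
    have int: "integrable M (\<lambda>x. exp (s * Y u x))"
      and mgf: "expectation (\<lambda>x. exp (s * Y u x)) = exp (s\<^sup>2 * Q u / 2)" for s u
      using R[THEN conjunct2, rule_format, of "\<lambda>i. s * u i"] unfolding sY sQ by auto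
    note N = centered_normal_rv_of_mgf[OF Ym psd[folded Q_def] int mgf]
    have Y1: "Y (\<lambda>k. if k = i then 1 else 0) x = X i x" if "i \<in> I" for i x
      using that by (simp add: Y_def unit)
    have sq: "integrable M (\<lambda>x. (Y u x)\<^sup>2)" for u
      using normal_rv_mgf(1)[OF N(1)] .
    have mean: "expectation (X i) = 0" if "i \<in> I" for i
      using N(2)[of "\<lambda>k. if k = i then 1 else 0"] that by (simp add: Y1 cong: Bochner_Integration.integral_cong)
    have cov: "covariance M (X i) (X k) = V i k" if ik: "i \<in> I" "k \<in> I" for i k
    proof -
      \<comment> \<open>Polarisation: 2 V i k is the form at \<open>e i\<close> + \<open>e k\<close>
        minus its values at \<open>e i\<close> and \<open>e k\<close>, and \<open>N(3)\<close>
        identifies these values with second moments.\<close>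
      define e where "e i l = (if l = i then 1 else 0 :: real)" for i l :: nat
      have Qe: "Q (e i) = V i i" if "i \<in> I" for i
        using that I unit by (simp add: Q_def e_def mult.assoc flip: sum_distrib_left)
      have Ye: "Y (e i) x = X i x" if "i \<in> I" for i x
        using that by (simp add: Y_def e_def unit)
      have Qs: "Q (\<lambda>l. e i l + e k l) = V i i + V k k + 2 * V i k"
      proof -
        have "Q (\<lambda>l. e i l + e k l) = (\<Sum>a\<in>I. e i a * (\<Sum>b\<in>I. e i b * V a b)) + (\<Sum>a\<in>I. e i a * (\<Sum>b\<in>I. e k b * V a b))
          + (\<Sum>a\<in>I. e k a * (\<Sum>b\<in>I. e i b * V a b)) + (\<Sum>a\<in>I. e k a * (\<Sum>b\<in>I. e k b * V a b))"
          by (simp add: Q_def algebra_simps sum.distrib sum_distrib_left)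
        then show ?thesis
          using ik sym[of k i] by (simp add: e_def unit)
      qed
      have Ys: "Y (\<lambda>l. e i l + e k l) x = X i x + X k x" for x
        using Ye[OF ik(1), of x] Ye[OF ik(2), of x] by (simp add: Y_def algebra_simps sum.distrib)
      have "integrable M (\<lambda>x. (X i x)\<^sup>2)" "integrable M (\<lambda>x. (X k x)\<^sup>2)" "integrable M (\<lambda>x. (X i x + X k x)\<^sup>2)"
        using sq[of "e i"] sq[of "e k"] sq[of "\<lambda>l. e i l + e k l"] by (simp_all only: Ye ik Ys)
      then have "expectation (\<lambda>x. ((X i x + X k x)\<^sup>2 - (X i x)\<^sup>2 - (X k x)\<^sup>2) / 2)
        = (expectation (\<lambda>x. (X i x + X k x)\<^sup>2) - expectation (\<lambda>x. (X i x)\<^sup>2) - expectation (\<lambda>x. (X k x)\<^sup>2)) / 2"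
        by simp
      also have "\<dots> = (Q (\<lambda>l. e i l + e k l) - Q (e i) - Q (e k)) / 2"
        using N(3)[of "e i"] N(3)[of "e k"] N(3)[of "\<lambda>l. e i l + e k l"] by (simp only: Ye ik Ys)
      also have "\<dots> = V i k"
        by (simp add: Qs Qe ik)
      finally show ?thesis
        using mean ik by (simp add: covariance_def power2_sum)
    qed
    show ?L
      using N(1) X mean cov by (auto simp: jointly_normal_def Y_def)
  }
qed

section \<open>Brownian motion on time grids\<close>

text \<open>Abel summation. Passing from m to m + 1 adds u (m + 1) to every tail sum, and the
  increments it multiplies telescope to X (m + 1).\<close>

lemma sum_by_parts_increments:
  fixes u X :: "nat \<Rightarrow> real"
  assumes "X 0 = 0"
  shows "(\<Sum>i=1..m. u i * X i) = (\<Sum>k<m. (\<Sum>l=Suc k..m. u l) * (X (Suc k) - X k))"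
proof (induction m)
  case (Suc m)
  \<comment> \<open>The tail sum from \<open>Suc m\<close> to m is empty, so the new index k = m
    contributes nothing to the old sum.\<close>
  have "(\<Sum>k<Suc m. (\<Sum>l=Suc k..Suc m. u l) * (X (Suc k) - X k))
      = (\<Sum>k<Suc m. (\<Sum>l=Suc k..m. u l) * (X (Suc k) - X k)) + u (Suc m) * (\<Sum>k<Suc m. X (Suc k) - X k)"
    by (simp add: sum_distrib_left sum.distrib[symmetric] algebra_simps del: sum.lessThan_Suc)
  also have "(\<Sum>k<Suc m. X (Suc k) - X k) = X (Suc m)"
    by (subst sum_lessThan_telescope) (simp add: assms)
  finally show ?case using Suc by simp
qed simp

text \<open>Tail sums are inverted by backward differences. Hence every coefficient vector for
  increments comes from one for values.\<close>

lemma exists_tail_sums: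
  fixes c :: "nat \<Rightarrow> real"
  shows "\<exists>u. \<forall>k<m. (\<Sum>l=Suc k..m. u l) = c k"
proof (intro exI allI impI)
  \<comment> \<open>Cutting c off to 0 at index m makes the telescoping sum of
    \<open>d (l - 1) - d l\<close> end in 0 instead of \<open>c m\<close>.\<close>
  define d where "d i = (if i < m then c i else 0)" for i
  have "(\<Sum>l=Suc k..n. d (l - 1) - d l) = d k - d n" if "k \<le> n" for k n
    using that by (induction rule: dec_induct) auto
  moreover fix k assume "k < m"
  ultimately show "(\<Sum>l=Suc k..m. d (l - 1) - d l) = c k"
    by (simp add: d_def)
qed

text \<open>Summation by parts in k is applied to min (t i) (t k), whose increments vanish from
  index i onwards; then the sums are exchanged. This diagonalises the covariance form in terms of
  tail sums.\<close>

lemma sum_min_quadratic_form: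
  fixes u t :: "nat \<Rightarrow> real"
  assumes t0: "t 0 = 0" and t: "\<And>i. i < m \<Longrightarrow> t i < t (Suc i)"
  shows "(\<Sum>i\<in>{1..m}. \<Sum>k\<in>{1..m}. u i * u k * min (t i) (t k))
    = (\<Sum>a<m. (\<Sum>l=Suc a..m. u l)\<^sup>2 * (t (Suc a) - t a))"
proof -
  have mono: "t i \<le> t k" if "i \<le> k" "k \<le> m" for i k
    using that(1,1,2) by (induction rule: dec_induct) (auto dest: t simp: Suc_le_eq intro: order_trans less_imp_le)
  let ?c = "\<lambda>a. \<Sum>l=Suc a..m. u l"
  have "(\<Sum>k\<in>{1..m}. u k * min (t i) (t k)) = (\<Sum>a<m. ?c a * (if a < i then t (Suc a) - t a else 0))"
    if i: "i \<in> {1..m}" for i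
  proof -
    have "(\<Sum>k\<in>{1..m}. u k * min (t i) (t k)) = (\<Sum>a<m. ?c a * (min (t i) (t (Suc a)) - min (t i) (t a)))"
      using mono[of 0 i] i t0 by (intro sum_by_parts_increments) auto
    also have "\<dots> = (\<Sum>a<m. ?c a * (if a < i then t (Suc a) - t a else 0))"
    proof (rule sum.cong[OF refl])
      fix a assume a: "a \<in> {..<m}"
      have "min (t i) (t (Suc a)) - min (t i) (t a) = (if a < i then t (Suc a) - t a else 0)"
        using a i mono[of "Suc a" i] mono[of a i] mono[of i a] mono[of i "Suc a"] by (auto simp: min_def)
      then show "?c a * (min (t i) (t (Suc a)) - min (t i) (t a)) = ?c a * (if a < i then t (Suc a) - t a else 0)"
        by simp
    qed
    finally show ?thesis .
  qed
  then have "(\<Sum>i\<in>{1..m}. \<Sum>k\<in>{1..m}. u i * u k * min (t i) (t k))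
      = (\<Sum>i\<in>{1..m}. u i * (\<Sum>a<m. ?c a * (if a < i then t (Suc a) - t a else 0)))"
    by (simp add: mult.assoc flip: sum_distrib_left)
  also have "\<dots> = (\<Sum>i\<in>{1..m}. \<Sum>a<m. ?c a * (t (Suc a) - t a) * (if a < i then u i else 0))"
    unfolding sum_distrib_left by (intro sum.cong) auto
  \<comment> \<open>After the exchange, the coefficients u i with a < i form a second tail sum,
    whence the square.\<close>
  also have "\<dots> = (\<Sum>a<m. \<Sum>i\<in>{1..m}. ?c a * (t (Suc a) - t a) * (if a < i then u i else 0))"
    by (rule sum.swap)
  also have "\<dots> = (\<Sum>a<m. ?c a * (t (Suc a) - t a) * (\<Sum>i\<in>{1..m}. if a < i then u i else 0))"
    by (simp add: sum_distrib_left)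
  also have "\<dots> = (\<Sum>a<m. ?c a * (t (Suc a) - t a) * ?c a)"
  proof -
    have "{i \<in> {1..m}. a < i} = {Suc a..m}" for a by auto
    then have "(\<Sum>i\<in>{1..m}. if a < i then u i else 0) = ?c a" for a
      by (simp flip: sum.inter_filter)
    then show ?thesis by simp
  qed
  finally show ?thesis
    by (simp add: power2_eq_square mult_ac)
qed

lemma prod_shift_grid:
  "(\<Prod>i=1..m. exp (1 / 2 * (\<Sum>l=i..m. u l)\<^sup>2 * (t i - t (i - 1))))
    = (\<Prod>k<m. exp (1 / 2 * (\<Sum>l=Suc k..m. u l)\<^sup>2 * (t (Suc k) - t k :: real)))"
  by (simp add: prod.atLeast_Suc_atMost_Suc_shift[of _ 0 "m - 1", simplified] lessThan_atLeast0 prod.atLeast1_atMost_eq)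

text \<open>Injectivity lets events indexed by J be carried to the image of J through the inverse of
  g. It serves to renumber increments after a grid has been extended at the front.\<close>

lemma (in prob_space) indep_vars_reindex:
  assumes "inj_on g J" and "indep_vars N X (g ` J)"
  shows "indep_vars (\<lambda>i. N (g i)) (\<lambda>i. X (g i)) J"
proof -
  have "indep_sets (\<lambda>i. F (g i)) J" if F: "indep_sets F (g ` J)" for F
  proof (rule indep_setsI)
    show "F (g i) \<subseteq> events" if "i \<in> J" for i
      using F that by (auto simp: indep_sets_def)
    fix A K assume K: "K \<noteq> {}" "K \<subseteq> J" "finite K" and A: "\<forall>i\<in>K. A i \<in> F (g i)"
    define A' where "A' = A \<circ> the_inv_into J g"
    have A': "A' (g i) = A i" if "i \<in> K" for i
      using K that assms(1) by (auto simp: A'_def the_inv_into_f_f)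
    have "prob (\<Inter>i\<in>g ` K. A' i) = (\<Prod>i\<in>g ` K. prob (A' i))"
      using K A A' by (intro indep_setsD[OF F]) auto
    moreover have "inj_on g K"
      using assms(1) K(2) by (rule inj_on_subset)
    ultimately show "prob (\<Inter>i\<in>K. A i) = (\<Prod>i\<in>K. prob (A i))"
      using A' by (simp add: prod.reindex)
  qed
  then show ?thesis
    using assms(2) unfolding indep_vars_def2 by auto
qed

section \<open>Equivalence of the three conditions on one grid\<close>

text \<open>Summation by parts turns the joint function of the values at u into that of the
  increments at the tail sums of u. Since tail sums exhaust all coefficient vectors,
  \<open>indep_centered_normal_iff_mgf\<close> applies.\<close>

lemma (in prob_space) indep_normal_increments_iff_mgf:
  assumes B0: "\<And>\<omega>. \<omega> \<in> space M \<Longrightarrow> blinfun_apply f (B 0 \<omega>) = 0" and t: "time_grid m t"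
  shows "indep_normal_increments M f B m t \<longleftrightarrow> brownian_joint_mgf M f B m t"
proof -
  define X where "X i \<omega> = blinfun_apply f (B (t i) \<omega>)" for i \<omega>
  define D where "D i \<omega> = X (Suc i) \<omega> - X i \<omega>" for i \<omega>
  have X0: "X 0 \<omega> = 0" if "\<omega> \<in> space M" for \<omega>
    using B0 t that by (simp add: X_def time_grid_def)
  have \<sigma>: "0 < sqrt (t (Suc i) - t i)" if "i < m" for i
    using t that by (auto simp: time_grid_def)
  have X_sum: "X i \<omega> = (\<Sum>k<i. D k \<omega>)" if "\<omega> \<in> space M" for i \<omega>
    unfolding D_def using X0[OF that] by (subst sum_lessThan_telescope) simp
  \<comment> \<open>Measurability transfers both ways because the process starts at 0 on
    \<open>space M\<close>: values are sums of increments, and \<open>X 0\<close>, needed for the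
    first increment, is constant there.\<close>
  have meas: "(\<forall>i<m. D i \<in> borel_measurable M) \<longleftrightarrow> (\<forall>i\<in>{1..m}. X i \<in> borel_measurable M)"
  proof
    assume D: "\<forall>i<m. D i \<in> borel_measurable M"
    show "\<forall>i\<in>{1..m}. X i \<in> borel_measurable M"
    proof
      fix i assume "i \<in> {1..m}"
      then have "(\<lambda>\<omega>. \<Sum>k<i. D k \<omega>) \<in> borel_measurable M"
        using D by (intro borel_measurable_sum) auto
      then show "X i \<in> borel_measurable M"
        by (subst measurable_cong[OF X_sum])
    qed
  next
    assume X: "\<forall>i\<in>{1..m}. X i \<in> borel_measurable M"
    have "X 0 \<in> borel_measurable M"
      by (subst measurable_cong[OF X0]) auto
    with X have "X i \<in> borel_measurable M" if "i \<le> m" for i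
      using that by (cases i) auto
    then show "\<forall>i<m. D i \<in> borel_measurable M"
      unfolding D_def by (intro allI impI borel_measurable_diff) auto
  qed
  let ?P = "\<lambda>c. integrable M (\<lambda>\<omega>. exp (\<Sum>k<m. c k * D k \<omega>)) \<and>
    expectation (\<lambda>\<omega>. exp (\<Sum>k<m. c k * D k \<omega>)) = (\<Prod>k<m. exp (1 / 2 * (c k)\<^sup>2 * (t (Suc k) - t k)))"
  have "brownian_joint_mgf M f B m t \<longleftrightarrow> (\<forall>i\<in>{1..m}. X i \<in> borel_measurable M) \<and>
    (\<forall>u. integrable M (\<lambda>\<omega>. exp (\<Sum>i=1..m. u i * X i \<omega>)) \<and>
        expectation (\<lambda>\<omega>. exp (\<Sum>i=1..m. u i * X i \<omega>))
          = (\<Prod>k<m. exp (1 / 2 * (\<Sum>l=Suc k..m. u l)\<^sup>2 * (t (Suc k) - t k))))"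
    by (simp only: brownian_joint_mgf_def prod_shift_grid X_def[abs_def])
  also have "\<dots> \<longleftrightarrow> (\<forall>i\<in>{1..m}. X i \<in> borel_measurable M) \<and> (\<forall>u. ?P (\<lambda>k. \<Sum>l=Suc k..m. u l))"
  proof -
    have "(\<Sum>i=1..m. u i * X i \<omega>) = (\<Sum>k<m. (\<Sum>l=Suc k..m. u l) * D k \<omega>)" if "\<omega> \<in> space M" for u \<omega>
      unfolding D_def using X0[OF that] by (rule sum_by_parts_increments)
    then show ?thesis
      by (simp cong: Bochner_Integration.integrable_cong Bochner_Integration.integral_cong)
  qed
  also have "\<dots> \<longleftrightarrow> (\<forall>i<m. D i \<in> borel_measurable M) \<and> (\<forall>c. ?P c)"
  proof -
    \<comment> \<open>The nontrivial direction takes u with prescribed tail sums c; only the indices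
      k < m enter.\<close>
    have eq: "(\<forall>u. ?P (\<lambda>k. \<Sum>l=Suc k..m. u l)) \<longleftrightarrow> (\<forall>c. ?P c)"
    proof (intro iffI allI)
      fix c :: "nat \<Rightarrow> real" assume P: "\<forall>u. ?P (\<lambda>k. \<Sum>l=Suc k..m. u l)"
      from exists_tail_sums[of m c] obtain u where u: "\<forall>k<m. (\<Sum>l=Suc k..m. u l) = c k" ..
      then have "(\<Sum>k<m. (\<Sum>l=Suc k..m. u l) * D k \<omega>) = (\<Sum>k<m. c k * D k \<omega>)" for \<omega>
        by (intro sum.cong) auto
      moreover from u have "(\<Prod>k<m. exp (1 / 2 * (\<Sum>l=Suc k..m. u l)\<^sup>2 * (t (Suc k) - t k)))
          = (\<Prod>k<m. exp (1 / 2 * (c k)\<^sup>2 * (t (Suc k) - t k)))"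
        by (intro prod.cong) auto
      ultimately show "?P c"
        using spec[OF P, of u] by (simp only:)
    next
      fix u :: "nat \<Rightarrow> real" assume "\<forall>c. ?P c"
      from spec[OF this, of "\<lambda>k. \<Sum>l=Suc k..m. u l"] show "?P (\<lambda>k. \<Sum>l=Suc k..m. u l)" .
    qed
    show ?thesis by (simp only: meas eq)
  qed
  also have "\<dots> \<longleftrightarrow> indep_vars (\<lambda>_. borel) D {..<m} \<and>
      (\<forall>i\<in>{..<m}. distributed M lborel (D i) (normal_density 0 (sqrt (t (Suc i) - t i))))"
    using indep_centered_normal_iff_mgf[of "{..<m}" "\<lambda>i. sqrt (t (Suc i) - t i)" D] \<sigma>
    by (simp add: less_imp_le Ball_def)
  also have "\<dots> \<longleftrightarrow> indep_normal_increments M f B m t"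
    by (simp add: indep_normal_increments_def D_def[abs_def] X_def blinfun.diff_right Ball_def)
  finally show ?thesis ..
qed

text \<open>By \<open>sum_min_quadratic_form\<close> the form is a combination of squares with
  positive coefficients. This yields both the semidefiniteness for
  \<open>jointly_normal_iff_mgf\<close> and the product shape of the moment generating
  function.\<close>

lemma (in prob_space) jointly_normal_min_covariance_iff_mgf:
  assumes t: "time_grid m t"
  shows "jointly_normal_min_covariance M f B m t \<longleftrightarrow> brownian_joint_mgf M f B m t"
proof -
  have t': "t 0 = 0" "\<And>i. i < m \<Longrightarrow> t i < t (Suc i)"
    using t by (auto simp: time_grid_def)
  have Q: "(\<Sum>i\<in>{1..m}. \<Sum>k\<in>{1..m}. u i * u k * min (t i) (t k))
    = (\<Sum>a<m. (\<Sum>l=Suc a..m. u l)\<^sup>2 * (t (Suc a) - t a))" for u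
    by (rule sum_min_quadratic_form) (fact t')+
  have "0 \<le> (\<Sum>i\<in>{1..m}. \<Sum>k\<in>{1..m}. u i * u k * min (t i) (t k))" for u
    unfolding Q using t' by (intro sum_nonneg mult_nonneg_nonneg) (auto intro: less_imp_le)
  note J = jointly_normal_iff_mgf[of "{1..m}" "\<lambda>i k. min (t i) (t k)", OF _ _ this]
  have "exp (1 / 2 * (\<Sum>i\<in>{1..m}. \<Sum>k\<in>{1..m}. u i * u k * min (t i) (t k)))
      = (\<Prod>i=1..m. exp (1 / 2 * (\<Sum>l=i..m. u l)\<^sup>2 * (t i - t (i - 1))))" for u
    unfolding Q prod_shift_grid by (simp add: exp_sum[symmetric] sum_divide_distrib)
  then show ?thesis
    unfolding jointly_normal_min_covariance_def brownian_joint_mgf_def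
    by (subst J) (auto simp: min.commute)
qed

section \<open>From time grids to Brownian motion\<close>

text \<open>Start and path continuity are assumed, so only increments are at stake. Grids start at 0
  while the increments in \<open>standard_brownian_motion\<close> may start later; this is bridged
  by inserting 0.\<close>

lemma (in prob_space) standard_brownian_motion_iff_increments:
  fixes B :: "real \<Rightarrow> 'a \<Rightarrow> ('k::topological_space \<Rightarrow>\<^sub>C real)"
  assumes B0: "\<And>\<omega>. \<omega> \<in> space M \<Longrightarrow> blinfun_apply f (B 0 \<omega>) = 0"
    and cont: "\<And>\<omega>. \<omega> \<in> space M \<Longrightarrow> continuous_on {0..} (\<lambda>t. blinfun_apply f (B t \<omega>))"
  shows "standard_brownian_motion M (\<lambda>t \<omega>. blinfun_apply f (B t \<omega>)) \<longleftrightarrow>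
    (\<forall>m t. time_grid m t \<longrightarrow> indep_normal_increments M f B m t)"
    (is "?L \<longleftrightarrow> ?R")
proof
  assume L: ?L
  show ?R
  proof (intro allI impI)
    fix m t assume t: "time_grid m t"
    have "0 \<le> t i" if "i \<le> m" for i
      using that
    proof (induction i)
      case (Suc i)
      then show ?case using t by (auto simp: time_grid_def Suc_le_eq intro: order_trans less_imp_le)
    qed (use t in \<open>simp add: time_grid_def\<close>)
    then show "indep_normal_increments M f B m t"
      using L t unfolding standard_brownian_motion_def indep_normal_increments_def time_grid_def blinfun.diff_right
      by auto
  qed
next
  assume R: ?R
  have ind: "indep_vars (\<lambda>_. borel) (\<lambda>i \<omega>. blinfun_apply f (B (t (Suc i)) \<omega>) - blinfun_apply f (B (t i) \<omega>)) {..<m}"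
    and nrm: "i < m \<Longrightarrow> distributed M lborel (\<lambda>\<omega>. blinfun_apply f (B (t (Suc i)) \<omega>) - blinfun_apply f (B (t i) \<omega>))
      (normal_density 0 (sqrt (t (Suc i) - t i)))" if "time_grid m t" for m t i
    using R that by (auto simp: indep_normal_increments_def blinfun.diff_right)
  \<comment> \<open>The increment over [s, t] occurs in the grid 0 < t or 0 < s < t, as increment
    number 0 or 1.\<close>
  have dist: "distributed M lborel (\<lambda>\<omega>. blinfun_apply f (B t \<omega>) - blinfun_apply f (B s \<omega>))
      (normal_density 0 (sqrt (t - s)))" if st: "0 \<le> s" "s < t" for s t
  proof (cases "s = 0")
    case True
    have "time_grid 1 (\<lambda>i. if i = 0 then 0 else t)"
      using st by (simp add: time_grid_def)
    from nrm[OF this, of 0] True show ?thesis by simp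
  next
    case False
    have "time_grid 2 (\<lambda>i. if i = 0 then 0 else if i = 1 then s else t)"
      using st False by (auto simp: time_grid_def)
    from nrm[OF this, of 1] show ?thesis by simp
  qed
  have meas: "(\<lambda>\<omega>. blinfun_apply f (B t \<omega>)) \<in> borel_measurable M" if "t \<ge> 0" for t
  proof (cases "t = 0")
    case True
    then show ?thesis using measurable_cong[of M "\<lambda>\<omega>. blinfun_apply f (B 0 \<omega>)" "\<lambda>_. 0"] B0 by simp
  next
    case False
    then have "(\<lambda>\<omega>. blinfun_apply f (B t \<omega>) - blinfun_apply f (B 0 \<omega>)) \<in> borel_measurable M"
      using distributed_measurable[OF dist[of 0 t]] that by simp
    then show ?thesis
      by (rule measurable_cong[THEN iffD1, rotated]) (simp add: B0)
  qed
  have "indep_vars (\<lambda>_. borel) (\<lambda>i \<omega>. blinfun_apply f (B (t (Suc i)) \<omega>) - blinfun_apply f (B (t i) \<omega>)) {..<m}"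
    if t: "0 \<le> t 0" "\<forall>i<m. t i < t (Suc i)" for m t
  \<comment> \<open>Grids have at least one step and start at 0: m = 0 is trivial, and t 0 = 0 calls
    for no extension.\<close>
  proof (cases "m = 0 \<or> t 0 = 0")
    case True
    then show ?thesis
      using ind[of m t] t by (cases "m = 0") (auto simp: time_grid_def indep_vars_def indep_sets_def)
  next
    case False
    \<comment> \<open>The sequence is prefixed with 0; the additional first increment is dropped by
      restricting to successor indices, which are then renumbered.\<close>
    let ?s = "case_nat 0 t"
    have "time_grid (Suc m) ?s"
      using t False by (auto simp: time_grid_def less_Suc_eq_0_disj)
    from ind[OF this] have "indep_vars (\<lambda>_. borel)
      (\<lambda>i \<omega>. blinfun_apply f (B (?s (Suc i)) \<omega>) - blinfun_apply f (B (?s i) \<omega>)) (Suc ` {..<m})"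
      by (rule indep_vars_subset) auto
    from indep_vars_reindex[OF _ this] show ?thesis
      by simp
  qed
  then show ?L
    using meas dist B0 cont by (auto simp: standard_brownian_motion_def)
qed

section \<open>Set-valued Brownian motion and its finite-dimensional laws\<close>

theorem theorem3p6:
  fixes M :: "'w measure"
    and j :: "'x::banach set \<Rightarrow> ('k::t2_space \<Rightarrow>\<^sub>C real)"
    and L :: "('k \<Rightarrow>\<^sub>C real) set"
    and W :: "real \<Rightarrow> 'w \<Rightarrow> 'x set"
  assumes "prob_space M"
    and "compact (UNIV :: 'k set)"
    and "ck_embedding j"
    and "f_algebra L"
    and "\<forall>t\<ge>0. \<forall>\<omega>\<in>space M. W t \<omega> \<in> ck"
    and "\<forall>t\<ge>0. \<forall>\<omega>\<in>space M. j (W t \<omega>) \<in> L"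
    and "\<forall>\<omega>\<in>space M. \<forall>g :: ('k \<Rightarrow>\<^sub>C real) \<Rightarrow>\<^sub>L real.
           continuous_on {0..} (\<lambda>t. blinfun_apply g (j (W t \<omega>)))"
    and "\<forall>\<omega>\<in>space M. W 0 \<omega> = {0}"
    and "\<forall>t\<ge>0. bochner_integrable M (\<lambda>\<omega>. j (W t \<omega>))"
    and "\<forall>t\<ge>0. bochner_integrable M (\<lambda>\<omega>. cmult (j (W t \<omega>)) (j (W t \<omega>)))"
  shows
    "(set_valued_brownian_motion M j (\<lambda>t \<omega>. j (W t \<omega>)) \<longleftrightarrow>
        (\<forall>f m t. evaluation_functional f \<and> time_grid m t \<longrightarrow>
           indep_normal_increments M f (\<lambda>t \<omega>. j (W t \<omega>)) m t)) \<and>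
     (set_valued_brownian_motion M j (\<lambda>t \<omega>. j (W t \<omega>)) \<longleftrightarrow>
        (\<forall>f m t. evaluation_functional f \<and> time_grid m t \<longrightarrow>
           jointly_normal_min_covariance M f (\<lambda>t \<omega>. j (W t \<omega>)) m t)) \<and>
     (set_valued_brownian_motion M j (\<lambda>t \<omega>. j (W t \<omega>)) \<longleftrightarrow>
        (\<forall>f m t. evaluation_functional f \<and> time_grid m t \<longrightarrow>
           brownian_joint_mgf M f (\<lambda>t \<omega>. j (W t \<omega>)) m t)) \<and>
     (\<forall>f m t. evaluation_functional f \<and> time_grid m t \<longrightarrow>
        (indep_normal_increments M f (\<lambda>t \<omega>. j (W t \<omega>)) m t \<longleftrightarrow>
           jointly_normal_min_covariance M f (\<lambda>t \<omega>. j (W t \<omega>)) m t) \<and>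
        (jointly_normal_min_covariance M f (\<lambda>t \<omega>. j (W t \<omega>)) m t \<longleftrightarrow>
           brownian_joint_mgf M f (\<lambda>t \<omega>. j (W t \<omega>)) m t))"
proof -
  interpret prob_space M by fact
  note embedding = \<open>ck_embedding j\<close> and ck = assms(5) and L = assms(4,6)
    and weakly_cont = assms(7) and W0 = assms(8) and integrable = assms(9,10)
  let ?B = "\<lambda>t \<omega>. j (W t \<omega>)"
  \<comment> \<open>With both scalars 0, the linearity rule for j gives j {0} = 0, so the start at
    the set {0} becomes a start at 0 in C(K).\<close>
  have "({0} :: 'x set) \<in> ck"
    by (simp add: ck_def)
  then have "j {\<alpha> *\<^sub>R a + \<beta> *\<^sub>R c | a c. a \<in> {0} \<and> c \<in> {0}} = \<alpha> *\<^sub>R j {0} + \<beta> *\<^sub>R j {0}"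
    if "\<alpha> \<ge> 0" "\<beta> \<ge> 0" for \<alpha> \<beta>
    using embedding that unfolding ck_embedding_def by blast
  from this[of 0 0] have j0: "j {0} = 0"
    by simp
  have B0: "blinfun_apply f (?B 0 \<omega>) = 0" if "\<omega> \<in> space M" for f \<omega>
    using W0 that by (simp add: j0 blinfun.zero_right)
  \<comment> \<open>The clauses on values, on L and on integrability hold by assumption, with r = 1
    for \<open>ck_r\<close>; only the evaluation functionals remain.\<close>
  have "set_valued_brownian_motion M j ?B \<longleftrightarrow>
      (\<forall>f. evaluation_functional f \<longrightarrow> standard_brownian_motion M (\<lambda>t \<omega>. blinfun_apply f (?B t \<omega>)))"
  proof -
    have "?B t \<omega> \<in> ck_r j" if "t \<ge> 0" "\<omega> \<in> space M" for t \<omega>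
      using ck that unfolding ck_r_def by (auto intro!: exI[of _ 1])
    moreover have "\<exists>L. f_algebra L \<and> (\<forall>t>0. \<forall>\<omega>\<in>space M. ?B t \<omega> \<in> L)"
      using L by (auto intro: less_imp_le)
    ultimately show ?thesis
      using integrable by (auto simp: set_valued_brownian_motion_def)
  qed
  also have "\<dots> \<longleftrightarrow> (\<forall>f m t. evaluation_functional f \<and> time_grid m t \<longrightarrow> indep_normal_increments M f ?B m t)"
    using standard_brownian_motion_iff_increments[of _ ?B] B0 weakly_cont by blast
  finally have increments: "set_valued_brownian_motion M j ?B \<longleftrightarrow>
      (\<forall>f m t. evaluation_functional f \<and> time_grid m t \<longrightarrow> indep_normal_increments M f ?B m t)" .
  \<comment> \<open>Both equivalences hold for each f and each grid separately, so they survive the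
    quantification.\<close>
  have i_iii: "indep_normal_increments M f ?B m t \<longleftrightarrow> brownian_joint_mgf M f ?B m t" if "time_grid m t" for f m t
    using B0 that by (rule indep_normal_increments_iff_mgf)
  have ii_iii: "jointly_normal_min_covariance M f ?B m t \<longleftrightarrow> brownian_joint_mgf M f ?B m t" if "time_grid m t" for f m t
    using that by (rule jointly_normal_min_covariance_iff_mgf)
  show ?thesis
    unfolding increments using i_iii ii_iii by blast
qed

end
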